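(* Let $F(t)$, $0\leqslant t<t_G$, be a deterministic c\`adl\`ag function, let $L$ be a (finite) random variable on $(\Omega,\mathscr F,\mathsf P)$, and let the process $M=(M_t)_{t\in\mathbb R_+}$ be given by $$M_t=F(t)\mathbf 1_{\{t<\gamma\}}+L\,\mathbf 1_{\{t\geqslant\gamma\}}.$$ The following statements are equivalent: (i) $M=(M_t)_{t\in\mathbb R_+}$ is a local martingale with respect to $\mathbb F$. (ii) $(M_t)_{t\in\mathcal T}$ is a martingale (with respect to $(\mathscr F_t)_{t\in\mathcal T}$). (iii) $\mathsf E(|M_t|)<\infty$ and $\mathsf E(M_t)=\mathsf E(M_0)$ for every $t\in\mathcal T$.
   Context: Setting. $(\Omega,\mathscr F,\mathsf P)$ is a probability space, $\gamma$ is a random variable with values in $[0,+\infty]$ with $\mathsf P(\gamma>0)>0$, $\mathbb R_+=[0,\infty)$, $G(t)=\mathsf P(\gamma\leqslant t)$ for $t\in\mathbb R_+$, $t_G=\sup\{t\in\mathbb R_+: G(t)<1\}\in(0,\infty]$, $\mathcal T=\{t\in\mathbb R_+:\mathsf P(\gamma\geqslant t)>0\}$. Thus $\mathcal T=[0,t_G]$ if $\mathsf P(\gamma=t_G<\infty)>0$ and $\mathcal T=[0,t_G)$ otherwise. Single jump filtration: $\mathbb F=(\mathscr F_t)_{t\in\mathbb R_+}$, where $\mathscr F_t$ is the collection of all $A\in\mathscr F$ such that $A\cap\{t<\gamma\}$ is either $\varnothing$ or equal to $\{t<\gamma\}$. This is an increasing right-continuous family of $\sigma$-fields; it is not assumed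 to be complete. A function is c\`adl\`ag on $[0,s)$ if it is right-continuous at every $t\in[0,s)$ and has a finite left limit at every $t\in(0,s)$ (no limit as $t\uparrow s$ is required). If $t_G<\infty$, $F$ is extended arbitrarily to a right-continuous function on $[t_G,\infty)$ (e.g. by $0$); since $\mathsf P(\gamma>t_G)=0$ in that case, the choice changes $M$ only on a set contained in $N\times\mathbb R_+$ with $\mathsf P(N)=0$. An adapted process $M$ with almost all paths c\`adl\`ag is a local martingale if there are stopping times $T_n$ with $T_n\uparrow\infty$ a.s. such that each stopped process $M^{T_n}$ is a uniformly integrable martingale. *)

theory Defs
  imports "HOL-Probability.Probability"
begin

section \<open>Processes indexed by nonnegative reals\<close>

text \<open>
  Times are reals; only values at times \<open>t \<ge> 0\<close> matter. Quantities with values in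
  \<open>[0, \<infinity>]\<close> have type \<^typ>\<open>ennreal\<close>, and a time \<open>t \<ge> 0\<close> is compared with them as
  \<open>ennreal t\<close>.
\<close>

text \<open>Nothing is required at the end point \<open>s\<close>.\<close>

definition cadlag_below :: "ennreal \<Rightarrow> (real \<Rightarrow> real) \<Rightarrow> bool" where
  "cadlag_below s f \<longleftrightarrow>
     (\<forall>t\<ge>0. ennreal t < s \<longrightarrow> continuous (at_right t) f) \<and>
     (\<forall>t>0. ennreal t < s \<longrightarrow> (\<exists>l. (f \<longlongrightarrow> l) (at_left t)))"

definition adapted_on :: "real set \<Rightarrow> (real \<Rightarrow> 'a measure) \<Rightarrow> (real \<Rightarrow> 'a \<Rightarrow> real) \<Rightarrow> bool" where
  "adapted_on I F X \<longleftrightarrow> (\<forall>t\<in>I. X t \<in> borel_measurable (F t))"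

definition martingale_on ::
  "'a measure \<Rightarrow> real set \<Rightarrow> (real \<Rightarrow> 'a measure) \<Rightarrow> (real \<Rightarrow> 'a \<Rightarrow> real) \<Rightarrow> bool" where
  "martingale_on P I F X \<longleftrightarrow>
     adapted_on I F X \<and>
     (\<forall>t\<in>I. integrable P (X t)) \<and>
     (\<forall>s\<in>I. \<forall>t\<in>I. s \<le> t \<longrightarrow> (AE \<omega> in P. real_cond_exp P (F s) (X t) \<omega> = X s \<omega>))"

definition uniformly_integrable_on ::
  "'a measure \<Rightarrow> real set \<Rightarrow> (real \<Rightarrow> 'a \<Rightarrow> real) \<Rightarrow> bool" where
  "uniformly_integrable_on P I X \<longleftrightarrow>
     ((\<lambda>c. SUP t\<in>I. \<integral>\<^sup>+ \<omega>. ennreal \<bar>X t \<omega>\<bar> * indicator {\<omega>. \<bar>X t \<omega>\<bar> > c} \<omega> \<partial>P)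
        \<longlongrightarrow> 0) at_top"

text \<open>
  The library's \<^const>\<open>stopping_time\<close> takes its values in the index type of the filtration;
  the following variant also allows the value \<open>\<infinity>\<close>.
\<close>

definition ext_stopping_time :: "(real \<Rightarrow> 'a measure) \<Rightarrow> ('a \<Rightarrow> ennreal) \<Rightarrow> bool" where
  "ext_stopping_time F T \<longleftrightarrow> (\<forall>t\<ge>0. Measurable.pred (F t) (\<lambda>\<omega>. T \<omega> \<le> ennreal t))"

definition stopped_process ::
  "(real \<Rightarrow> 'a \<Rightarrow> real) \<Rightarrow> ('a \<Rightarrow> ennreal) \<Rightarrow> real \<Rightarrow> 'a \<Rightarrow> real" where
  "stopped_process X T t \<omega> = X (enn2real (min (ennreal t) (T \<omega>))) \<omega>"

definition local_martingale ::
  "'a measure \<Rightarrow> (real \<Rightarrow> 'a measure) \<Rightarrow> (real \<Rightarrow> 'a \<Rightarrow> real) \<Rightarrow> bool" where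
  "local_martingale P F X \<longleftrightarrow>
     adapted_on {0..} F X \<and>
     (AE \<omega> in P. cadlag_below \<infinity> (\<lambda>t. X t \<omega>)) \<and>
     (\<exists>T :: nat \<Rightarrow> 'a \<Rightarrow> ennreal.
        (\<forall>n. ext_stopping_time F (T n)) \<and>
        (AE \<omega> in P. incseq (\<lambda>n. T n \<omega>) \<and> (\<lambda>n. T n \<omega>) \<longlonglongrightarrow> \<infinity>) \<and>
        (\<forall>n. martingale_on P {0..} F (stopped_process X (T n)) \<and>
             uniformly_integrable_on P {0..} (stopped_process X (T n))))"

section \<open>Single jump filtrations\<close>

definition before_jump :: "'a measure \<Rightarrow> ('a \<Rightarrow> ennreal) \<Rightarrow> real \<Rightarrow> 'a set" where
  "before_jump P \<gamma> t = {\<omega> \<in> space P. ennreal t < \<gamma> \<omega>}"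

definition single_jump_sets :: "'a measure \<Rightarrow> ('a \<Rightarrow> ennreal) \<Rightarrow> real \<Rightarrow> 'a set set" where
  "single_jump_sets P \<gamma> t =
     {A \<in> sets P. A \<inter> before_jump P \<gamma> t = {} \<or> A \<inter> before_jump P \<gamma> t = before_jump P \<gamma> t}"

text \<open>
  Only the underlying \<open>\<sigma>\<close>-field of these measures is relevant; it is exactly the collection
  above, see \<open>sets_single_jump_filtration\<close>.
\<close>

definition single_jump_filtration ::
  "'a measure \<Rightarrow> ('a \<Rightarrow> ennreal) \<Rightarrow> real \<Rightarrow> 'a measure" where
  "single_jump_filtration P \<gamma> t = sigma (space P) (single_jump_sets P \<gamma> t)"

definition jump_end :: "'a measure \<Rightarrow> ('a \<Rightarrow> ennreal) \<Rightarrow> ennreal" where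
  "jump_end P \<gamma> =
     Sup {ennreal t | t. t \<ge> 0 \<and> measure P {\<omega> \<in> space P. \<gamma> \<omega> \<le> ennreal t} < 1}"

definition jump_times :: "'a measure \<Rightarrow> ('a \<Rightarrow> ennreal) \<Rightarrow> real set" where
  "jump_times P \<gamma> = {t. t \<ge> 0 \<and> measure P {\<omega> \<in> space P. \<gamma> \<omega> \<ge> ennreal t} > 0}"

definition single_jump_process ::
  "('a \<Rightarrow> ennreal) \<Rightarrow> (real \<Rightarrow> real) \<Rightarrow> ('a \<Rightarrow> real) \<Rightarrow> real \<Rightarrow> 'a \<Rightarrow> real" where
  "single_jump_process \<gamma> F L t \<omega> =
     F t * indicator {\<omega>. ennreal t < \<gamma> \<omega>} \<omega> + L \<omega> * indicator {\<omega>. ennreal t \<ge> \<gamma> \<omega>} \<omega>"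

lemma sigma_algebra_single_jump_sets:
  "sigma_algebra (space P) (single_jump_sets P \<gamma> t)"
  unfolding sigma_algebra_iff2
proof (intro conjI ballI allI impI)
  show "single_jump_sets P \<gamma> t \<subseteq> Pow (space P)"
    using sets.sets_into_space by (auto simp: single_jump_sets_def)
  show "{} \<in> single_jump_sets P \<gamma> t"
    by (simp add: single_jump_sets_def)
next
  fix A assume "A \<in> single_jump_sets P \<gamma> t"
  moreover have "before_jump P \<gamma> t \<subseteq> space P" by (auto simp: before_jump_def)
  ultimately show "space P - A \<in> single_jump_sets P \<gamma> t"
    by (auto simp: single_jump_sets_def)
next
  fix A :: "nat \<Rightarrow> 'a set" assume A: "range A \<subseteq> single_jump_sets P \<gamma> t"
  then have "(\<Union>i. A i) \<in> sets P"
    by (auto simp: single_jump_sets_def)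
  moreover have "A i \<inter> before_jump P \<gamma> t = {} \<or> before_jump P \<gamma> t \<subseteq> A i" for i
  proof -
    have "A i \<in> single_jump_sets P \<gamma> t" using A by auto
    then show ?thesis by (auto simp: single_jump_sets_def)
  qed
  ultimately show "(\<Union>i. A i) \<in> single_jump_sets P \<gamma> t"
    unfolding single_jump_sets_def by blast
qed

lemma space_single_jump_filtration: "space (single_jump_filtration P \<gamma> t) = space P"
  by (simp add: single_jump_filtration_def space_measure_of_conv)

lemma sets_single_jump_filtration:
  "sets (single_jump_filtration P \<gamma> t) = single_jump_sets P \<gamma> t"
  unfolding single_jump_filtration_def
  by (rule sigma_algebra.sets_measure_of_eq[OF sigma_algebra_single_jump_sets])

lemma subalgebra_single_jump_filtration: "subalgebra P (single_jump_filtration P \<gamma> t)"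
  by (auto simp: subalgebra_def space_single_jump_filtration sets_single_jump_filtration
      single_jump_sets_def)

lemma filtration_single_jump_filtration:
  "filtration (space P) (single_jump_filtration P \<gamma>)"
proof
  fix s t :: real assume "s \<le> t"
  then have "before_jump P \<gamma> t \<subseteq> before_jump P \<gamma> s"
    by (auto simp: before_jump_def intro: le_less_trans ennreal_leI)
  then show "sets (single_jump_filtration P \<gamma> s) \<le> sets (single_jump_filtration P \<gamma> t)"
    by (auto simp: sets_single_jump_filtration single_jump_sets_def)
qed (rule space_single_jump_filtration)

end

theory Submission
  imports Defs
begin

text \<open>
  Before the jump an observer only knows that it has not happened yet: every event of the
  \<open>\<sigma>\<close>-field at time \<open>t\<close> contains or misses the whole of \<open>{t < \<gamma>}\<close>. After the jump \<open>M\<close> no longer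
  moves. The pivot is the third statement (the mean of \<open>M\<close> is constant on \<open>\<T>\<close>), to which each
  of the other two is shown to be equivalent.

  Constant mean gives the martingale property. Let \<open>s \<le> t\<close> and let \<open>A\<close> be an event at time \<open>s\<close>. If
  \<open>A\<close> misses \<open>{s < \<gamma>}\<close>, then \<open>M s = L = M t\<close> on \<open>A\<close>. Otherwise the complement of \<open>A\<close> misses
  \<open>{s < \<gamma>}\<close>, and equality of the two means transfers the equality of integrals from the complement
  to \<open>A\<close> (\<open>set_integral_process_eq\<close>).

  Constant mean gives the local martingale property. The localizing time for \<open>u \<in> \<T>\<close> is \<open>u\<close> if
  the jump comes after \<open>u\<close> and \<open>\<infinity>\<close> if it does not. Since \<open>M\<close> is constant after the jump, stopping
  it there is the same as freezing it at the deterministic time \<open>u\<close> (\<open>stopped_at_jump_cutoff\<close>), but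
  the value \<open>\<infinity>\<close> lets these times tend to infinity even if \<open>\<T>\<close> is bounded. The frozen process is
  dominated by an integrable variable: constancy of the mean gives
  \<open>F t * P(\<gamma> > t) = E(M u; \<gamma> > t)\<close> for \<open>t \<le> u\<close> (\<open>level_times_survival\<close>), and \<open>P(\<gamma> > t)\<close> is at
  least \<open>P(\<gamma> \<ge> u) > 0\<close> if \<open>t < u\<close>. The same identity yields the left limit of \<open>F\<close> at
  the end point \<open>t\<^sub>G\<close> when the jump occurs there with positive probability, so that almost all
  paths are right-continuous with left limits.

  A local martingale has constant mean. A stopping time \<open>T\<close> cannot act before the jump on one
  outcome without acting on all outcomes that have not jumped yet. Hence, if
  \<open>T \<ge> t\<close> for a single outcome with \<open>\<gamma> \<ge> t\<close>, then \<open>T \<ge> t\<close> or \<open>T \<ge> \<gamma>\<close> everywhere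
  (\<open>stopping_time_dichotomy\<close>), and stopping at \<open>T\<close> does not change \<open>M t\<close>. For \<open>t \<in> \<T>\<close>, the event
  \<open>\<gamma> \<ge> t\<close> has positive probability, so such an outcome exists for some member of any localizing
  sequence, and \<open>M t\<close> inherits integrability and mean from a true martingale.
\<close>

section \<open>Domination and uniform integrability\<close>

lemma dominated_imp_uniformly_integrable:
  fixes X :: "real \<Rightarrow> 'a \<Rightarrow> real"
  assumes Y: "integrable P Y" and dom: "\<And>t \<omega>. t \<in> I \<Longrightarrow> \<bar>X t \<omega>\<bar> \<le> Y \<omega>"
  shows "uniformly_integrable_on P I X"
  unfolding uniformly_integrable_on_def
proof (rule tendsto_sandwich[where f = "\<lambda>_. 0"])
  have [measurable]: "Y \<in> borel_measurable P" using Y by auto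
  let ?tail = "\<lambda>c. \<integral>\<omega>. \<bar>Y \<omega>\<bar> * indicator {\<omega>. Y \<omega> > c} \<omega> \<partial>P"
  have "(?tail \<longlongrightarrow> (\<integral>\<omega>. 0 \<partial>P)) at_top"
  proof (rule integral_dominated_convergence_at_top[where w = "\<lambda>\<omega>. \<bar>Y \<omega>\<bar>"])
    show "AE \<omega> in P. ((\<lambda>c. \<bar>Y \<omega>\<bar> * indicator {\<omega>. Y \<omega> > c} \<omega>) \<longlongrightarrow> 0) at_top"
    proof (intro AE_I2 tendsto_eventually)
      fix \<omega>
      show "\<forall>\<^sub>F c in at_top. \<bar>Y \<omega>\<bar> * indicator {\<omega>. Y \<omega> > c} \<omega> = 0"
        using eventually_ge_at_top[of "Y \<omega>"] by eventually_elim simp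
    qed
  qed (use Y in \<open>auto simp: indicator_def\<close>)
  then show "((\<lambda>c. ennreal (?tail c)) \<longlongrightarrow> 0) at_top"
    using tendsto_ennrealI[of ?tail 0] by simp
  show "\<forall>\<^sub>F c in at_top. (SUP t\<in>I. \<integral>\<^sup>+ \<omega>. ennreal \<bar>X t \<omega>\<bar> * indicator {\<omega>. \<bar>X t \<omega>\<bar> > c} \<omega> \<partial>P)
      \<le> ennreal (?tail c)"
  proof (intro always_eventually allI SUP_least)
    fix c t assume t: "t \<in> I"
    have "(\<integral>\<^sup>+ \<omega>. ennreal \<bar>X t \<omega>\<bar> * indicator {\<omega>. \<bar>X t \<omega>\<bar> > c} \<omega> \<partial>P)
        \<le> (\<integral>\<^sup>+ \<omega>. ennreal (\<bar>Y \<omega>\<bar> * indicator {\<omega>. Y \<omega> > c} \<omega>) \<partial>P)"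
    proof (rule nn_integral_mono)
      fix \<omega>
      show "ennreal \<bar>X t \<omega>\<bar> * indicator {\<omega>. \<bar>X t \<omega>\<bar> > c} \<omega>
          \<le> ennreal (\<bar>Y \<omega>\<bar> * indicator {\<omega>. Y \<omega> > c} \<omega>)"
        using dom[OF t, of \<omega>] by (auto simp: indicator_def intro!: ennreal_leI)
    qed
    also have "\<dots> = ennreal (?tail c)"
    proof (rule nn_integral_eq_integral)
      show "integrable P (\<lambda>\<omega>. \<bar>Y \<omega>\<bar> * indicator {\<omega>. Y \<omega> > c} \<omega>)"
        by (rule Bochner_Integration.integrable_bound[OF Y]) (auto simp: indicator_def)
    qed simp
    finally show "(\<integral>\<^sup>+ \<omega>. ennreal \<bar>X t \<omega>\<bar> * indicator {\<omega>. \<bar>X t \<omega>\<bar> > c} \<omega> \<partial>P)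
        \<le> ennreal (?tail c)" .
  qed
qed auto

section \<open>The single jump process\<close>

locale single_jump = prob_space P for P :: "'a measure" +
  fixes \<gamma> :: "'a \<Rightarrow> ennreal" and F :: "real \<Rightarrow> real" and L :: "'a \<Rightarrow> real"
  assumes measurable_jump [measurable]: "\<gamma> \<in> borel_measurable P"
    and measurable_terminal [measurable]: "L \<in> borel_measurable P"
begin

abbreviation M :: "real \<Rightarrow> 'a \<Rightarrow> real" where
  "M \<equiv> single_jump_process \<gamma> F L"

abbreviation \<F> :: "real \<Rightarrow> 'a measure" where
  "\<F> \<equiv> single_jump_filtration P \<gamma>"

abbreviation \<T> :: "real set" where
  "\<T> \<equiv> jump_times P \<gamma>"

definition constant_mean :: bool where
  "constant_mean \<longleftrightarrow> (\<forall>t\<in>\<T>. integrable P (M t) \<and> expectation (M t) = expectation (M 0))"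

lemma process_before_jump: "ennreal t < \<gamma> \<omega> \<Longrightarrow> M t \<omega> = F t"
  by (auto simp: single_jump_process_def not_le)

lemma process_after_jump: "\<gamma> \<omega> \<le> ennreal t \<Longrightarrow> M t \<omega> = L \<omega>"
  by (auto simp: single_jump_process_def not_less)

lemma measurable_process [measurable]: "M t \<in> borel_measurable P"
  unfolding single_jump_process_def by measurable

lemma process_adapted: "M t \<in> borel_measurable (\<F> t)"
proof (rule measurableI)
  fix B :: "real set" assume B [measurable]: "B \<in> sets borel"
  let ?A = "M t -` B \<inter> space P"
  have "?A \<inter> before_jump P \<gamma> t = (if F t \<in> B then before_jump P \<gamma> t else {})"
    by (auto simp: before_jump_def process_before_jump)
  moreover have "?A \<in> sets P" by measurable
  ultimately show "M t -` B \<inter> space (\<F> t) \<in> sets (\<F> t)"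
    by (auto simp: sets_single_jump_filtration space_single_jump_filtration single_jump_sets_def)
qed simp

lemma zero_in_jump_times: "0 \<in> \<T>"
  by (simp add: jump_times_def prob_space)

lemma jump_times_downward:
  assumes "t \<in> \<T>" "0 \<le> s" "s \<le> t"
  shows "s \<in> \<T>"
proof -
  have "prob {\<omega> \<in> space P. \<gamma> \<omega> \<ge> ennreal t} \<le> prob {\<omega> \<in> space P. \<gamma> \<omega> \<ge> ennreal s}"
    by (intro finite_measure_mono) (auto intro: order_trans[OF ennreal_leI[OF assms(3)]])
  with assms show ?thesis by (auto simp: jump_times_def)
qed

section \<open>Constant mean implies the martingale property\<close>

text \<open>
  An event at time \<open>s\<close> or its complement lies in \<open>{\<gamma> \<le> s}\<close>, where both processes equal \<open>L\<close>;
  equality of the means makes the two cases equivalent.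
\<close>

lemma set_integral_process_eq:
  assumes "0 \<le> s" "s \<le> t" and A: "A \<in> sets (\<F> s)"
    and int: "integrable P (M s)" "integrable P (M t)"
    and mean: "expectation (M s) = expectation (M t)"
  shows "(\<integral>\<omega>\<in>A. M t \<omega> \<partial>P) = (\<integral>\<omega>\<in>A. M s \<omega> \<partial>P)"
proof -
  have equal_off_jump: "(\<integral>\<omega>\<in>B. M t \<omega> \<partial>P) = (\<integral>\<omega>\<in>B. M s \<omega> \<partial>P)"
    if B: "B \<in> sets P" "B \<inter> before_jump P \<gamma> s = {}" for B
  proof (rule set_lebesgue_integral_cong[OF B(1)], intro allI impI)
    fix \<omega> assume "\<omega> \<in> B"
    with B have "\<gamma> \<omega> \<le> ennreal s"
      using sets.sets_into_space by (fastforce simp: before_jump_def)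
    moreover from this have "\<gamma> \<omega> \<le> ennreal t"
      using order_trans[OF _ ennreal_leI[OF \<open>s \<le> t\<close>]] by blast
    ultimately show "M t \<omega> = M s \<omega>" by (simp add: process_after_jump)
  qed
  have complement: "(\<integral>\<omega>\<in>A. X \<omega> \<partial>P) = expectation X - (\<integral>\<omega>\<in>space P - A. X \<omega> \<partial>P)"
    if "integrable P X" "A \<in> sets P" for X :: "'a \<Rightarrow> real"
  proof -
    have "(\<integral>\<omega>\<in>space P. X \<omega> \<partial>P) = (\<integral>\<omega>\<in>A \<union> (space P - A). X \<omega> \<partial>P)"
      using sets.sets_into_space[OF that(2)] by (simp add: Un_absorb1)
    also have "\<dots> = (\<integral>\<omega>\<in>A. X \<omega> \<partial>P) + (\<integral>\<omega>\<in>space P - A. X \<omega> \<partial>P)"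
      using that by (intro set_integral_Un)
        (auto simp only: set_integrable_def Diff_disjoint
          intro!: integrable_mult_indicator sets.compl_sets)
    finally show ?thesis using that(1) by (simp add: set_integral_space)
  qed
  have "A \<in> sets P" and "A \<inter> before_jump P \<gamma> s = {} \<or> before_jump P \<gamma> s \<subseteq> A"
    using A by (auto simp: sets_single_jump_filtration single_jump_sets_def)
  then show ?thesis
  proof (elim disjE)
    assume "A \<in> sets P" "A \<inter> before_jump P \<gamma> s = {}"
    then show ?thesis by (rule equal_off_jump)
  next
    assume A: "A \<in> sets P" "before_jump P \<gamma> s \<subseteq> A"
    then have "(\<integral>\<omega>\<in>space P - A. M t \<omega> \<partial>P) = (\<integral>\<omega>\<in>space P - A. M s \<omega> \<partial>P)"
      by (intro equal_off_jump) auto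
    then show ?thesis
      using complement[OF int(1) A(1)] complement[OF int(2) A(1)] mean by simp
  qed
qed

lemma sigma_finite_subalgebra_filtration: "sigma_finite_subalgebra P (\<F> t)"
  by (rule finite_measure_subalgebra_is_sigma_finite)
    (simp add: finite_measure_subalgebra_def finite_measure_subalgebra_axioms_def
      subalgebra_single_jump_filtration finite_measure_axioms)

lemma cond_exp_process:
  assumes cm: constant_mean and "s \<in> \<T>" "t \<in> \<T>" "s \<le> t"
  shows "AE \<omega> in P. real_cond_exp P (\<F> s) (M t) \<omega> = M s \<omega>"
proof (rule sigma_finite_subalgebra.real_cond_exp_charact[OF sigma_finite_subalgebra_filtration])
  show int: "integrable P (M t)" "integrable P (M s)"
    using assms by (auto simp: constant_mean_def)
  have "0 \<le> s" using \<open>s \<in> \<T>\<close> by (simp add: jump_times_def)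
  then show "(\<integral>\<omega>\<in>A. M t \<omega> \<partial>P) = (\<integral>\<omega>\<in>A. M s \<omega> \<partial>P)" if "A \<in> sets (\<F> s)" for A
    using that cm assms(2-4) int by (intro set_integral_process_eq) (auto simp: constant_mean_def)
qed (rule process_adapted)

lemma martingale_iff_constant_mean: "martingale_on P \<T> \<F> M \<longleftrightarrow> constant_mean"
proof
  assume mart: "martingale_on P \<T> \<F> M"
  show constant_mean
    unfolding constant_mean_def
  proof (intro ballI conjI)
    fix t assume t: "t \<in> \<T>"
    then show int: "integrable P (M t)" using mart by (simp add: martingale_on_def)
    have "0 \<le> t" using t by (simp add: jump_times_def)
    with mart t zero_in_jump_times have "AE \<omega> in P. real_cond_exp P (\<F> 0) (M t) \<omega> = M 0 \<omega>"
      by (auto simp: martingale_on_def)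
    then have "expectation (real_cond_exp P (\<F> 0) (M t)) = expectation (M 0)"
      by (intro integral_cong_AE borel_measurable_cond_exp2) auto
    then show "expectation (M t) = expectation (M 0)"
      using sigma_finite_subalgebra.real_cond_exp_int(2)[OF sigma_finite_subalgebra_filtration int]
      by simp
  qed
next
  assume constant_mean
  then show "martingale_on P \<T> \<F> M"
    unfolding martingale_on_def adapted_on_def
    using process_adapted cond_exp_process by (auto simp: constant_mean_def)
qed

text \<open>
  At conditioning times after \<open>u\<close> the frozen process is already known; at earlier ones the
  martingale property on \<open>\<T>\<close> applies. The process is an arbitrary
  \<open>X\<close> that agrees with the frozen one at nonnegative times, because stopped processes behave
  differently at the meaningless negative ones.
\<close>

lemma frozen_process_martingale:
  assumes cm: constant_mean and u: "u \<in> \<T>"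
    and X: "\<And>t. 0 \<le> t \<Longrightarrow> X t = M (min t u)"
  shows "martingale_on P {0..} \<F> X"
proof -
  have u0: "0 \<le> u" using u by (simp add: jump_times_def)
  have min_in: "min t u \<in> \<T>" if "0 \<le> t" for t
    using u u0 that by (auto intro: jump_times_downward)
  have adapted: "X t \<in> borel_measurable (\<F> t)" if "0 \<le> t" for t
  proof -
    have "sets (\<F> (min t u)) \<subseteq> sets (\<F> t)"
      by (rule filtration.sets_F_mono[OF filtration_single_jump_filtration]) simp
    then have "subalgebra (\<F> t) (\<F> (min t u))"
      by (simp add: subalgebra_def space_single_jump_filtration)
    from measurable_from_subalg[OF this process_adapted] show ?thesis by (simp add: X that)
  qed
  have int: "integrable P (X t)" if "0 \<le> t" for t
    using cm min_in[OF that] by (simp add: X that constant_mean_def)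
  have "AE \<omega> in P. real_cond_exp P (\<F> s) (X t) \<omega> = X s \<omega>" if st: "0 \<le> s" "s \<le> t" for s t
  proof (cases "s \<le> u")
    case True
    then have "X s = M s" "X t = M (min t u)" using st by (auto simp: X)
    with True st min_in[of s] min_in[of t] cond_exp_process[OF cm, of s "min t u"] show ?thesis
      by simp
  next
    case False
    then have "X t = X s" using st by (simp add: X)
    then show ?thesis
      using sigma_finite_subalgebra.real_cond_exp_F_meas[OF sigma_finite_subalgebra_filtration]
        int[of s] adapted[of s] st by simp
  qed
  with adapted int show ?thesis by (auto simp: martingale_on_def adapted_on_def)
qed

section \<open>Bounds and limits of the deterministic part\<close>

text \<open>
  This is the equality of the integrals of \<open>M t\<close> and \<open>M u\<close> over \<open>{t < \<gamma>}\<close>, an event at time \<open>t\<close>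
  on which \<open>M t\<close> is the number \<open>F t\<close>. It expresses \<open>F\<close> on \<open>[0, u)\<close> as a quotient of integrals, which
  gives the bound and the left limit below.
\<close>

lemma level_times_survival:
  assumes cm: constant_mean and u: "u \<in> \<T>" and t: "0 \<le> t" "t \<le> u"
  shows "F t * prob {\<omega> \<in> space P. ennreal t < \<gamma> \<omega>}
    = (\<integral>\<omega>. M u \<omega> * indicator {\<omega>. ennreal t < \<gamma> \<omega>} \<omega> \<partial>P)"
proof -
  have tT: "t \<in> \<T>" using u t by (rule jump_times_downward)
  have "before_jump P \<gamma> t \<in> sets (\<F> t)"
    by (simp add: sets_single_jump_filtration single_jump_sets_def before_jump_def)
  then have "(\<integral>\<omega>\<in>before_jump P \<gamma> t. M u \<omega> \<partial>P) = (\<integral>\<omega>\<in>before_jump P \<gamma> t. M t \<omega> \<partial>P)"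
    using cm tT u t by (intro set_integral_process_eq) (auto simp: constant_mean_def)
  also have "\<dots> = (\<integral>\<omega>\<in>before_jump P \<gamma> t. F t \<partial>P)"
    by (rule set_lebesgue_integral_cong)
      (auto simp: before_jump_def process_before_jump)
  also have "\<dots> = F t * prob {\<omega> \<in> space P. ennreal t < \<gamma> \<omega>}"
    by (simp add: set_lebesgue_integral_def before_jump_def mult.commute)
  finally have "F t * prob {\<omega> \<in> space P. ennreal t < \<gamma> \<omega>}
      = (\<integral>\<omega>\<in>before_jump P \<gamma> t. M u \<omega> \<partial>P)" by (rule sym)
  also have "\<dots> = (\<integral>\<omega>. M u \<omega> * indicator {\<omega>. ennreal t < \<gamma> \<omega>} \<omega> \<partial>P)"
    unfolding set_lebesgue_integral_def
    by (rule Bochner_Integration.integral_cong) (auto simp: before_jump_def indicator_def)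
  finally show ?thesis .
qed

lemma level_bound:
  assumes cm: constant_mean and u: "u \<in> \<T>" and t: "0 \<le> t" "t < u"
  shows "\<bar>F t\<bar> \<le> (\<integral>\<omega>. \<bar>M u \<omega>\<bar> \<partial>P) / prob {\<omega> \<in> space P. ennreal u \<le> \<gamma> \<omega>}"
proof -
  let ?p = "prob {\<omega> \<in> space P. ennreal u \<le> \<gamma> \<omega>}"
  let ?q = "prob {\<omega> \<in> space P. ennreal t < \<gamma> \<omega>}"
  have int: "integrable P (M u)" using cm u by (simp add: constant_mean_def)
  have p: "?p > 0" using u by (simp add: jump_times_def)
  have lt: "ennreal t < ennreal u" using t by (simp add: ennreal_less_iff)
  have pq: "?p \<le> ?q"
    by (intro finite_measure_mono) (auto intro: less_le_trans[OF lt])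
  have "\<bar>F t\<bar> * ?p \<le> \<bar>F t\<bar> * ?q" using pq by (intro mult_left_mono) auto
  also have "\<dots> = \<bar>F t * ?q\<bar>" by (simp add: abs_mult)
  also have "\<dots> = \<bar>\<integral>\<omega>. M u \<omega> * indicator {\<omega>. ennreal t < \<gamma> \<omega>} \<omega> \<partial>P\<bar>"
    using level_times_survival[OF cm u] t by simp
  also have "\<dots> \<le> (\<integral>\<omega>. \<bar>M u \<omega> * indicator {\<omega>. ennreal t < \<gamma> \<omega>} \<omega>\<bar> \<partial>P)"
    by (rule integral_abs_bound)
  also have "\<dots> \<le> (\<integral>\<omega>. \<bar>M u \<omega>\<bar> \<partial>P)"
    using int by (intro integral_mono') (auto simp: indicator_def)
  finally show ?thesis using p by (simp add: field_simps)
qed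

lemma survival_integral_left_limit:
  fixes f :: "'a \<Rightarrow> real"
  assumes f: "integrable P f" and u: "0 < u"
  shows "((\<lambda>t. \<integral>\<omega>. f \<omega> * indicator {\<omega>. ennreal t < \<gamma> \<omega>} \<omega> \<partial>P)
    \<longlongrightarrow> (\<integral>\<omega>. f \<omega> * indicator {\<omega>. ennreal u \<le> \<gamma> \<omega>} \<omega> \<partial>P)) (at_left u)"
proof (rule tendsto_at_left_sequentially[OF u])
  fix S :: "nat \<Rightarrow> real"
  assume S: "\<And>n. S n < u" "\<And>n. 0 < S n" "incseq S" "S \<longlonglongrightarrow> u"
  have [measurable]: "f \<in> borel_measurable P" using f by auto
  show "(\<lambda>n. \<integral>\<omega>. f \<omega> * indicator {\<omega>. ennreal (S n) < \<gamma> \<omega>} \<omega> \<partial>P)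
    \<longlonglongrightarrow> (\<integral>\<omega>. f \<omega> * indicator {\<omega>. ennreal u \<le> \<gamma> \<omega>} \<omega> \<partial>P)"
  proof (rule integral_dominated_convergence[where w = "\<lambda>\<omega>. \<bar>f \<omega>\<bar>"])
    show "AE \<omega> in P. (\<lambda>n. f \<omega> * indicator {\<omega>. ennreal (S n) < \<gamma> \<omega>} \<omega>)
      \<longlonglongrightarrow> f \<omega> * indicator {\<omega>. ennreal u \<le> \<gamma> \<omega>} \<omega>"
    proof (rule AE_I2)
      fix \<omega>
      have "\<forall>\<^sub>F n in sequentially. (ennreal (S n) < \<gamma> \<omega>) = (ennreal u \<le> \<gamma> \<omega>)"
      proof (cases "ennreal u \<le> \<gamma> \<omega>")
        case True
        then have "ennreal (S n) < \<gamma> \<omega>" for n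
          using ennreal_lessI[OF u S(1)] by (rule less_le_trans[rotated])
        then show ?thesis using True by simp
      next
        case False
        have "(\<lambda>n. ennreal (S n)) \<longlonglongrightarrow> ennreal u" using S(4) by (rule tendsto_ennrealI)
        from order_tendstoD(1)[OF this, of "\<gamma> \<omega>"] False show ?thesis
          by (auto simp: not_le elim!: eventually_mono)
      qed
      then have "\<forall>\<^sub>F n in sequentially. f \<omega> * indicator {\<omega>. ennreal (S n) < \<gamma> \<omega>} \<omega>
          = f \<omega> * indicator {\<omega>. ennreal u \<le> \<gamma> \<omega>} \<omega>"
        by eventually_elim (simp add: indicator_def)
      then show "(\<lambda>n. f \<omega> * indicator {\<omega>. ennreal (S n) < \<gamma> \<omega>} \<omega>)
          \<longlonglongrightarrow> f \<omega> * indicator {\<omega>. ennreal u \<le> \<gamma> \<omega>} \<omega>"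
        by (rule tendsto_eventually)
    qed
  qed (use f in \<open>auto simp: indicator_def\<close>)
qed

text \<open>
  Both sides of the quotient converge as \<open>t\<close> increases to \<open>u\<close>, the denominator to
  \<open>P(\<gamma> \<ge> u) > 0\<close>. The case of interest is \<open>u = t\<^sub>G\<close>, where the regularity assumed of \<open>F\<close> says
  nothing about a left limit.
\<close>

lemma level_left_limit:
  assumes cm: constant_mean and u: "u \<in> \<T>" "0 < u"
  shows "\<exists>l. (F \<longlongrightarrow> l) (at_left u)"
proof -
  let ?N = "\<lambda>t. \<integral>\<omega>. M u \<omega> * indicator {\<omega>. ennreal t < \<gamma> \<omega>} \<omega> \<partial>P"
  let ?q = "\<lambda>t. prob {\<omega> \<in> space P. ennreal t < \<gamma> \<omega>}"
  let ?p = "prob {\<omega> \<in> space P. ennreal u \<le> \<gamma> \<omega>}"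
  have p: "?p > 0" using u by (simp add: jump_times_def)
  have int: "integrable P (M u)" using cm u by (simp add: constant_mean_def)
  have survival: "(\<integral>\<omega>. 1 * indicator {\<omega>. Q \<omega>} \<omega> \<partial>P) = prob {\<omega> \<in> space P. Q \<omega>}" for Q
  proof -
    have "{\<omega>. Q \<omega>} \<inter> space P = {\<omega> \<in> space P. Q \<omega>}" by blast
    then show ?thesis by simp
  qed
  have "integrable P (\<lambda>_. 1 :: real)" by simp
  from survival_integral_left_limit[OF this u(2)] have q: "(?q \<longlongrightarrow> ?p) (at_left u)"
    unfolding survival .
  have "((\<lambda>t. ?N t / ?q t) \<longlongrightarrow>
      (\<integral>\<omega>. M u \<omega> * indicator {\<omega>. ennreal u \<le> \<gamma> \<omega>} \<omega> \<partial>P) / ?p) (at_left u)"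
    using p by (intro tendsto_divide survival_integral_left_limit int u(2) q) auto
  moreover have "\<forall>\<^sub>F t in at_left u. ?N t / ?q t = F t"
  proof -
    have "\<forall>\<^sub>F t in at_left u. t \<in> {0<..<u}" using u(2) by (rule eventually_at_left_real)
    then show ?thesis
    proof eventually_elim
      case (elim t)
      then have lt: "ennreal t < ennreal u" by (simp add: ennreal_less_iff)
      have "?p \<le> ?q t"
        by (intro finite_measure_mono) (auto intro: less_le_trans[OF lt])
      with p level_times_survival[OF cm u(1), of t] elim show ?case by (simp add: field_simps)
    qed
  qed
  ultimately show ?thesis by (intro exI) (rule Lim_transform_eventually)
qed

section \<open>Constant mean implies the local martingale property\<close>

text \<open>
  Before \<open>u\<close> the process is either at \<open>F t\<close>, which is bounded, or already at its value \<open>L = M u\<close>;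
  from \<open>u\<close> on it equals \<open>M u\<close>.
\<close>

lemma frozen_process_uniformly_integrable:
  assumes cm: constant_mean and u: "u \<in> \<T>"
    and X: "\<And>t. 0 \<le> t \<Longrightarrow> X t = M (min t u)"
  shows "uniformly_integrable_on P {0..} X"
proof -
  let ?C = "(\<integral>\<omega>. \<bar>M u \<omega>\<bar> \<partial>P) / prob {\<omega> \<in> space P. ennreal u \<le> \<gamma> \<omega>}"
  have C: "0 \<le> ?C" by (intro divide_nonneg_nonneg) auto
  show ?thesis
  proof (rule dominated_imp_uniformly_integrable[where Y = "\<lambda>\<omega>. ?C + \<bar>M u \<omega>\<bar>"])
    show "integrable P (\<lambda>\<omega>. ?C + \<bar>M u \<omega>\<bar>)"
      using cm u by (auto simp: constant_mean_def)
    fix t :: real and \<omega> assume "t \<in> {0..}"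
    then have t: "0 \<le> t" by simp
    show "\<bar>X t \<omega>\<bar> \<le> ?C + \<bar>M u \<omega>\<bar>"
    proof (cases "t < u")
      case False
      then show ?thesis using C t by (simp add: X)
    next
      case True
      show ?thesis
      proof (cases "ennreal t < \<gamma> \<omega>")
        case before: True
        then show ?thesis
          using level_bound[OF cm u t True] True by (simp add: X t process_before_jump)
      next
        case False
        then have "\<gamma> \<omega> \<le> ennreal t" "\<gamma> \<omega> \<le> ennreal u"
          using order_trans[OF _ ennreal_leI[OF less_imp_le[OF True]]] by (auto simp: not_less)
        then show ?thesis using True C by (simp add: X t process_after_jump)
      qed
    qed
  qed
qed

text \<open>
  The value \<open>\<infinity>\<close> on \<open>{\<gamma> \<le> u}\<close> loses nothing, since \<open>M\<close> is constant from the jump on. It is needed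
  when \<open>\<T>\<close> is bounded, as the times \<open>u\<close> themselves then cannot tend to infinity.
\<close>

definition jump_cutoff :: "real \<Rightarrow> 'a \<Rightarrow> ennreal" where
  "jump_cutoff u \<omega> = (if ennreal u < \<gamma> \<omega> then ennreal u else \<infinity>)"

lemma jump_cutoff_stopping_time: "ext_stopping_time \<F> (jump_cutoff u)"
  unfolding ext_stopping_time_def
proof (intro allI impI)
  fix t :: real assume "0 \<le> t"
  have eq: "{\<omega> \<in> space P. jump_cutoff u \<omega> \<le> ennreal t}
      = (if ennreal u \<le> ennreal t then before_jump P \<gamma> u else {})"
    by (auto simp: jump_cutoff_def before_jump_def top_unique)
  have [measurable]: "before_jump P \<gamma> u \<in> sets P" by (simp add: before_jump_def)
  have "before_jump P \<gamma> t \<subseteq> before_jump P \<gamma> u" if "ennreal u \<le> ennreal t"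
    using that by (auto simp: before_jump_def)
  then have "{\<omega> \<in> space P. jump_cutoff u \<omega> \<le> ennreal t} \<in> sets (\<F> t)"
    unfolding eq sets_single_jump_filtration by (auto simp: single_jump_sets_def)
  then show "Measurable.pred (\<F> t) (\<lambda>\<omega>. jump_cutoff u \<omega> \<le> ennreal t)"
    by (simp add: pred_def space_single_jump_filtration)
qed

lemma stopped_at_jump_cutoff:
  assumes "0 \<le> u" "0 \<le> t"
  shows "stopped_process M (jump_cutoff u) t = M (min t u)"
proof
  fix \<omega>
  show "stopped_process M (jump_cutoff u) t \<omega> = M (min t u) \<omega>"
  proof (cases "ennreal u < \<gamma> \<omega>")
    case True
    have "min (ennreal t) (ennreal u) = ennreal (min t u)"
      using assms by (auto simp: min_def ennreal_le_iff)
    then show ?thesis using True assms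
      by (simp add: stopped_process_def jump_cutoff_def)
  next
    case False
    then have after: "\<gamma> \<omega> \<le> ennreal u" by simp
    have "M t \<omega> = M u \<omega>" if "u \<le> t"
      using after order_trans[OF after ennreal_leI[OF that]] by (simp add: process_after_jump)
    then show ?thesis using False assms
      by (simp add: stopped_process_def jump_cutoff_def min_def)
  qed
qed

text \<open>
  The supremum defining \<open>t\<^sub>G\<close> says that \<open>P(\<gamma> \<le> t) = 1\<close> for each real \<open>t > t\<^sub>G\<close>; countably many such
  \<open>t\<close> decreasing to \<open>t\<^sub>G\<close> suffice.
\<close>

lemma jump_le_end: "AE \<omega> in P. \<gamma> \<omega> \<le> jump_end P \<gamma>"
proof (cases "jump_end P \<gamma>")
  case top
  then show ?thesis by simp
next
  case (real r)
  have "AE \<omega> in P. \<gamma> \<omega> \<le> ennreal (r + 1 / real (Suc n))" for n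
  proof -
    define t where "t = r + 1 / real (Suc n)"
    have rt: "r < t" by (simp add: t_def)
    have "\<not> prob {\<omega> \<in> space P. \<gamma> \<omega> \<le> ennreal t} < 1"
    proof
      assume "prob {\<omega> \<in> space P. \<gamma> \<omega> \<le> ennreal t} < 1"
      then have "ennreal t \<le> jump_end P \<gamma>"
        unfolding jump_end_def using real(1) rt by (intro Sup_upper) auto
      then show False using real rt by (simp add: ennreal_le_iff)
    qed
    then have "prob {\<omega> \<in> space P. \<gamma> \<omega> \<le> ennreal t} = 1"
      using prob_le_1 by (meson antisym not_less)
    then show ?thesis unfolding t_def[symmetric] by (subst (asm) prob_Collect_eq_1) auto
  qed
  then have "AE \<omega> in P. \<forall>n. \<gamma> \<omega> \<le> ennreal (r + 1 / real (Suc n))"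
    by (simp add: AE_all_countable)
  then show ?thesis
  proof eventually_elim
    case (elim \<omega>)
    have "(\<lambda>n. ennreal (r + 1 / real (Suc n))) \<longlonglongrightarrow> ennreal (r + 0)"
      by (intro tendsto_ennrealI tendsto_add tendsto_const LIMSEQ_Suc lim_1_over_n)
    with elim show ?case
      using real by (intro LIMSEQ_le_const[where X = "\<lambda>n. ennreal (r + 1 / real (Suc n))"]) auto
  qed
qed

text \<open>
  If \<open>t\<^sub>G\<close> is finite and belongs to \<open>\<T>\<close>, then cutting off at \<open>t\<^sub>G\<close> is already the infinite time,
  almost surely. Otherwise elements of \<open>\<T>\<close> increase to \<open>t\<^sub>G\<close>: if it is infinite, their cutoffs are
  at least as large as they are; if it is finite, almost every jump happens strictly before
  \<open>t\<^sub>G\<close>, and the cutoffs are eventually \<open>\<infinity>\<close>.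
\<close>

lemma exhausting_times:
  assumes pos: "prob {\<omega> \<in> space P. \<gamma> \<omega> > 0} > 0"
  obtains u :: "nat \<Rightarrow> real"
  where "\<And>n. u n \<in> \<T>" "incseq u" "AE \<omega> in P. (\<lambda>n. jump_cutoff (u n) \<omega>) \<longlonglongrightarrow> \<infinity>"
proof (cases "\<exists>r\<in>\<T>. jump_end P \<gamma> = ennreal r")
  case True
  then obtain r where r: "r \<in> \<T>" "jump_end P \<gamma> = ennreal r" by auto
  have "AE \<omega> in P. (\<lambda>n. jump_cutoff r \<omega>) \<longlonglongrightarrow> \<infinity>"
    using jump_le_end
  proof eventually_elim
    case (elim \<omega>)
    then have "jump_cutoff r \<omega> = \<infinity>" by (simp add: jump_cutoff_def r(2) leD)
    then show ?case by simp
  qed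
  with r that[of "\<lambda>_. r"] show ?thesis by (simp add: incseq_def)
next
  case False
  let ?S = "{ennreal t | t. t \<ge> 0 \<and> prob {\<omega> \<in> space P. \<gamma> \<omega> \<le> ennreal t} < 1}"
  have "prob {\<omega> \<in> space P. \<not> \<gamma> \<omega> > 0} = 1 - prob {\<omega> \<in> space P. \<gamma> \<omega> > 0}"
    by (rule prob_neg) measurable
  then have "prob {\<omega> \<in> space P. \<gamma> \<omega> \<le> ennreal 0} < 1"
    using pos by (simp add: not_less)
  then have "ennreal 0 \<in> ?S" by blast
  then have "?S \<noteq> {}" by blast
  from ennreal_Sup_countable_SUP[OF this] obtain f :: "nat \<Rightarrow> ennreal"
    where f: "incseq f" "range f \<subseteq> ?S" "jump_end P \<gamma> = (SUP n. f n)"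
    unfolding jump_end_def by auto
  define u where "u n = enn2real (f n)" for n
  have fu: "f n = ennreal (u n)" for n
  proof -
    obtain t where "t \<ge> 0" "f n = ennreal t" using f(2) by blast
    then show ?thesis by (simp add: u_def)
  qed
  have u0: "0 \<le> u n" for n by (simp add: u_def)
  have uT: "u n \<in> \<T>" for n
  proof -
    obtain t where "f n = ennreal t" "prob {\<omega> \<in> space P. \<gamma> \<omega> \<le> ennreal t} < 1"
      using f(2) by blast
    then have "prob {\<omega> \<in> space P. \<gamma> \<omega> \<le> ennreal (u n)} < 1"
      using fu[of n] by simp
    moreover have "prob {\<omega> \<in> space P. \<not> (\<gamma> \<omega> \<le> ennreal (u n))}
        = 1 - prob {\<omega> \<in> space P. \<gamma> \<omega> \<le> ennreal (u n)}"
      by (rule prob_neg) measurable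
    moreover have "prob {\<omega> \<in> space P. \<not> (\<gamma> \<omega> \<le> ennreal (u n))}
        \<le> prob {\<omega> \<in> space P. \<gamma> \<omega> \<ge> ennreal (u n)}"
      by (intro finite_measure_mono) auto
    ultimately show ?thesis using u0 by (auto simp: jump_times_def)
  qed
  have "incseq u"
    using f(1) u0 by (auto simp: incseq_def fu ennreal_le_iff)
  have "f = (\<lambda>n. ennreal (u n))" using fu by (rule ext)
  with LIMSEQ_SUP[OF f(1)] f(3) have lim: "(\<lambda>n. ennreal (u n)) \<longlonglongrightarrow> jump_end P \<gamma>"
    by simp
  have "AE \<omega> in P. (\<lambda>n. jump_cutoff (u n) \<omega>) \<longlonglongrightarrow> \<infinity>"
  proof (cases "jump_end P \<gamma>")
    case top
    show ?thesis
    proof (rule AE_I2)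
      fix \<omega>
      have "(\<lambda>n. ennreal (u n)) \<longlonglongrightarrow> \<infinity>" using lim top by simp
      then show "(\<lambda>n. jump_cutoff (u n) \<omega>) \<longlonglongrightarrow> \<infinity>"
        by (rule tendsto_sandwich[OF _ _ _ tendsto_const, rotated 2]) (simp_all add: jump_cutoff_def)
    qed
  next
    case (real r)
    then have "r \<notin> \<T>" using False by auto
    then have "prob {\<omega> \<in> space P. \<gamma> \<omega> \<ge> ennreal r} = 0"
      using real(1) measure_nonneg[of P] by (simp add: jump_times_def zero_less_measure_iff)
    then have "AE \<omega> in P. \<not> \<gamma> \<omega> \<ge> ennreal r"
      by (subst (asm) prob_Collect_eq_0) measurable
    then show ?thesis
    proof eventually_elim
      case (elim \<omega>)
      then have "\<forall>\<^sub>F n in sequentially. \<gamma> \<omega> < ennreal (u n)"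
        using order_tendstoD(1)[OF lim, of "\<gamma> \<omega>"] real(2) by (simp only: not_le)
      then have "\<forall>\<^sub>F n in sequentially. jump_cutoff (u n) \<omega> = \<infinity>"
        by eventually_elim (simp add: jump_cutoff_def)
      then show ?case by (rule tendsto_eventually)
    qed
  qed
  with uT \<open>incseq u\<close> that show ?thesis by blast
qed

text \<open>
  A path follows \<open>F\<close> up to the jump and is constant afterwards, so left limits of \<open>F\<close> are required
  at times \<open>t \<le> \<gamma> \<le> t\<^sub>G\<close> only. The one time not covered by the assumption on \<open>F\<close> is \<open>t = \<gamma> = t\<^sub>G\<close>; either
  this has probability zero or \<open>t\<^sub>G \<in> \<T>\<close> and the constant mean provides the limit.
\<close>

lemma process_paths_cadlag:
  assumes cm: constant_mean
    and cadlag: "cadlag_below (jump_end P \<gamma>) F"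
    and right_cont: "\<And>t. t \<ge> 0 \<Longrightarrow> jump_end P \<gamma> \<le> ennreal t \<Longrightarrow> continuous (at_right t) F"
  shows "AE \<omega> in P. cadlag_below \<infinity> (\<lambda>t. M t \<omega>)"
proof -
  have no_mass: "AE \<omega> in P. \<not> (jump_end P \<gamma> \<noteq> \<infinity> \<and> enn2real (jump_end P \<gamma>) \<notin> \<T>
      \<and> jump_end P \<gamma> \<le> \<gamma> \<omega>)"
  proof (cases "jump_end P \<gamma> \<noteq> \<infinity> \<and> enn2real (jump_end P \<gamma>) \<notin> \<T>")
    case True
    then have "prob {\<omega> \<in> space P. \<gamma> \<omega> \<ge> jump_end P \<gamma>} = 0"
      by (auto simp: jump_times_def zero_less_measure_iff less_top)
    then show ?thesis by (subst (asm) prob_Collect_eq_0) auto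
  qed auto
  show ?thesis
    using jump_le_end no_mass
  proof eventually_elim
    case (elim \<omega>)
    show ?case
      unfolding cadlag_below_def
    proof (intro conjI allI impI)
      fix t :: real assume t: "t \<ge> 0" "ennreal t < \<infinity>"
      show "continuous (at_right t) (\<lambda>t. M t \<omega>)"
      proof (cases "ennreal t < \<gamma> \<omega>")
        case True
        have "continuous (at_right t) F"
          using cadlag right_cont t by (cases "ennreal t < jump_end P \<gamma>") (auto simp: cadlag_below_def)
        then have "(F \<longlongrightarrow> F t) (at_right t)" by (simp add: continuous_within)
        moreover have "\<forall>\<^sub>F s in at_right t. F s = M s \<omega>"
        proof -
          have "((\<lambda>s. ennreal s) \<longlongrightarrow> ennreal t) (at_right t)"
            by (intro tendsto_ennrealI tendsto_ident_at)
          from order_tendstoD(2)[OF this True] show ?thesis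
            by eventually_elim (simp add: process_before_jump)
        qed
        ultimately show ?thesis
          using True by (simp add: continuous_within process_before_jump tendsto_cong)
      next
        case False
        then have "\<gamma> \<omega> \<le> ennreal t" by simp
        have "\<forall>\<^sub>F s in at_right t. t < s" by (rule eventually_at_right_less)
        then have "\<forall>\<^sub>F s in at_right t. M s \<omega> = M t \<omega>"
        proof eventually_elim
          case (elim s)
          then have "\<gamma> \<omega> \<le> ennreal s"
            using order_trans[OF \<open>\<gamma> \<omega> \<le> ennreal t\<close> ennreal_leI] by simp
          with \<open>\<gamma> \<omega> \<le> ennreal t\<close> show ?case by (simp add: process_after_jump)
        qed
        then show ?thesis by (simp add: continuous_within tendsto_eventually)
      qed
    next
      fix t :: real assume t: "t > 0" "ennreal t < \<infinity>"
      have near: "\<forall>\<^sub>F s in at_left t. s < t" "((\<lambda>s. ennreal s) \<longlongrightarrow> ennreal t) (at_left t)"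
        by (auto intro: tendsto_ennrealI tendsto_ident_at simp: eventually_at_filter)
      show "\<exists>l. ((\<lambda>t. M t \<omega>) \<longlongrightarrow> l) (at_left t)"
      proof (cases "\<gamma> \<omega> < ennreal t")
        case True
        from order_tendstoD(1)[OF near(2) this]
        have "\<forall>\<^sub>F s in at_left t. M s \<omega> = L \<omega>"
          by eventually_elim (simp add: process_after_jump)
        then show ?thesis by (intro exI) (rule tendsto_eventually)
      next
        case False
        then have tg: "ennreal t \<le> \<gamma> \<omega>" by simp
        have "\<exists>l. (F \<longlongrightarrow> l) (at_left t)"
        proof (cases "ennreal t < jump_end P \<gamma>")
          case True
          then show ?thesis using cadlag t by (auto simp: cadlag_below_def)
        next
          case False
          then have "jump_end P \<gamma> = ennreal t" using tg elim(1) by auto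
          with elim(2) tg t have "t \<in> \<T>" by simp
          then show ?thesis using level_left_limit[OF cm] t by simp
        qed
        then obtain l where "(F \<longlongrightarrow> l) (at_left t)" by blast
        moreover have "\<forall>\<^sub>F s in at_left t. F s = M s \<omega>"
          using near(1)
        proof eventually_elim
          case (elim s)
          then have "ennreal s < \<gamma> \<omega>" using tg t by (intro less_le_trans[OF ennreal_lessI])
          then show ?case by (simp add: process_before_jump)
        qed
        ultimately show ?thesis by (intro exI) (rule Lim_transform_eventually)
      qed
    qed
  qed
qed

lemma constant_mean_imp_local_martingale:
  assumes pos: "prob {\<omega> \<in> space P. \<gamma> \<omega> > 0} > 0"
    and cm: constant_mean
    and cadlag: "cadlag_below (jump_end P \<gamma>) F"
    and right_cont: "\<And>t. t \<ge> 0 \<Longrightarrow> jump_end P \<gamma> \<le> ennreal t \<Longrightarrow> continuous (at_right t) F"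
  shows "local_martingale P \<F> M"
proof -
  obtain u where u: "\<And>n. u n \<in> \<T>" "incseq u" "AE \<omega> in P. (\<lambda>n. jump_cutoff (u n) \<omega>) \<longlonglongrightarrow> \<infinity>"
    using exhausting_times[OF pos] by blast
  have u0: "0 \<le> u n" for n using u(1)[of n] by (simp add: jump_times_def)
  have "incseq (\<lambda>n. jump_cutoff (u n) \<omega>)" for \<omega>
  proof (rule incseq_SucI)
    fix n
    have "ennreal (u n) \<le> ennreal (u (Suc n))"
      using incseq_SucD[OF u(2)] by (rule ennreal_leI)
    then show "jump_cutoff (u n) \<omega> \<le> jump_cutoff (u (Suc n)) \<omega>"
      by (auto simp: jump_cutoff_def)
  qed
  then have exhausting:
    "AE \<omega> in P. incseq (\<lambda>n. jump_cutoff (u n) \<omega>) \<and> (\<lambda>n. jump_cutoff (u n) \<omega>) \<longlonglongrightarrow> \<infinity>"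
    using u(3) by simp
  have stopped: "martingale_on P {0..} \<F> (stopped_process M (jump_cutoff (u n)))
      \<and> uniformly_integrable_on P {0..} (stopped_process M (jump_cutoff (u n)))" for n
    using frozen_process_martingale[OF cm u(1)] frozen_process_uniformly_integrable[OF cm u(1)]
      stopped_at_jump_cutoff[OF u0] by blast
  have "adapted_on {0..} \<F> M" by (simp add: adapted_on_def process_adapted)
  moreover note process_paths_cadlag[OF cm cadlag right_cont]
  ultimately show ?thesis
    unfolding local_martingale_def
    by (intro conjI exI[of _ "\<lambda>n. jump_cutoff (u n)"] allI exhausting
        jump_cutoff_stopping_time stopped[THEN conjunct1] stopped[THEN conjunct2])
qed

section \<open>Local martingales have constant mean\<close>

text \<open>
  If \<open>T\<close> took a value \<open>s\<close> below both \<open>t\<close> and \<open>\<gamma>\<close> at some outcome, then \<open>{T \<le> s}\<close>, an event at time \<open>s\<close>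
  that meets \<open>{s < \<gamma>}\<close>, would contain all of \<open>{s < \<gamma>}\<close> and with it the outcome \<open>\<omega>\<^sub>0\<close>,
  where \<open>T \<ge> t > s\<close>.
\<close>

lemma stopping_time_dichotomy:
  assumes T: "ext_stopping_time \<F> T"
    and \<omega>\<^sub>0: "\<omega>\<^sub>0 \<in> space P" "ennreal t \<le> \<gamma> \<omega>\<^sub>0" "ennreal t \<le> T \<omega>\<^sub>0"
    and \<omega>: "\<omega> \<in> space P"
  shows "ennreal t \<le> T \<omega> \<or> \<gamma> \<omega> \<le> T \<omega>"
proof (rule ccontr)
  assume "\<not> ?thesis"
  then have less: "T \<omega> < ennreal t" "T \<omega> < \<gamma> \<omega>" by auto
  define s where "s = enn2real (T \<omega>)"
  have s: "T \<omega> = ennreal s" "0 \<le> s"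
    using less_trans[OF less(1) ennreal_less_top] by (simp_all add: s_def)
  let ?A = "{\<omega> \<in> space P. T \<omega> \<le> ennreal s}"
  have "?A \<in> sets (\<F> s)"
    using T s(2) by (auto simp: ext_stopping_time_def pred_def space_single_jump_filtration)
  then have "?A \<inter> before_jump P \<gamma> s = {} \<or> before_jump P \<gamma> s \<subseteq> ?A"
    by (auto simp: sets_single_jump_filtration single_jump_sets_def)
  moreover have "\<omega> \<in> ?A \<inter> before_jump P \<gamma> s"
    using \<omega> less s by (auto simp: before_jump_def)
  ultimately have "before_jump P \<gamma> s \<subseteq> ?A" by blast
  moreover have "\<omega>\<^sub>0 \<in> before_jump P \<gamma> s"
    using \<omega>\<^sub>0 less s by (auto simp: before_jump_def)
  ultimately have "T \<omega>\<^sub>0 \<le> ennreal s" by blast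
  with \<omega>\<^sub>0 less s show False by auto
qed

lemma stopped_process_unchanged:
  assumes t: "0 \<le> t" and "ennreal t \<le> T \<omega> \<or> \<gamma> \<omega> \<le> T \<omega>"
  shows "stopped_process M T t \<omega> = M t \<omega>"
proof (cases "ennreal t \<le> T \<omega>")
  case True
  then show ?thesis using t by (simp add: stopped_process_def min_def)
next
  case False
  then have "\<gamma> \<omega> \<le> T \<omega>" "T \<omega> < ennreal t" using assms(2) by auto
  then have "\<gamma> \<omega> \<le> ennreal t" "ennreal (enn2real (T \<omega>)) = T \<omega>"
    using less_trans[OF _ ennreal_less_top] by auto
  with \<open>\<gamma> \<omega> \<le> T \<omega>\<close> False show ?thesis
    by (simp add: stopped_process_def min_def process_after_jump)
qed

lemma local_martingale_imp_constant_mean: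
  assumes "local_martingale P \<F> M"
  shows constant_mean
  unfolding constant_mean_def
proof (intro ballI)
  fix t assume tT: "t \<in> \<T>"
  then have t: "0 \<le> t" by (simp add: jump_times_def)
  obtain T where T: "\<And>n. ext_stopping_time \<F> (T n)"
      "AE \<omega> in P. (\<lambda>n. T n \<omega>) \<longlonglongrightarrow> \<infinity>"
      "\<And>n. martingale_on P {0..} \<F> (stopped_process M (T n))"
    using assms unfolding local_martingale_def by (fastforce elim: eventually_mono)
  \<comment> \<open>A single outcome decides how far the stopping time reaches on the whole space.\<close>
  obtain \<omega>\<^sub>0 where \<omega>\<^sub>0: "\<omega>\<^sub>0 \<in> space P" "ennreal t \<le> \<gamma> \<omega>\<^sub>0" "(\<lambda>n. T n \<omega>\<^sub>0) \<longlonglongrightarrow> \<infinity>"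
  proof -
    have "\<not> (AE \<omega> in P. \<not> ennreal t \<le> \<gamma> \<omega>)"
      using tT prob_Collect_eq_0[of "\<lambda>\<omega>. ennreal t \<le> \<gamma> \<omega>"] by (simp add: jump_times_def)
    moreover have "AE \<omega> in P. \<not> ennreal t \<le> \<gamma> \<omega>"
      if "\<nexists>\<omega>. \<omega> \<in> space P \<and> ennreal t \<le> \<gamma> \<omega> \<and> (\<lambda>n. T n \<omega>) \<longlonglongrightarrow> \<infinity>"
      using T(2) AE_space by eventually_elim (use that in blast)
    ultimately show ?thesis using that by blast
  qed
  from order_tendstoD(1)[OF \<omega>\<^sub>0(3), of "ennreal t"] obtain n where n: "ennreal t < T n \<omega>\<^sub>0"
    by (auto simp: eventually_sequentially)
  let ?X = "stopped_process M (T n)"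
  have X: "?X t \<omega> = M t \<omega>" if "\<omega> \<in> space P" for \<omega>
    using stopping_time_dichotomy[OF T(1) \<omega>\<^sub>0(1,2) _ that, of n] n t
    by (intro stopped_process_unchanged) auto
  have X0: "?X 0 = M 0" by (rule ext) (simp add: stopped_process_def)
  have int: "integrable P (?X t)" and cond: "AE \<omega> in P. real_cond_exp P (\<F> 0) (?X t) \<omega> = ?X 0 \<omega>"
    using T(3)[of n] t by (auto simp: martingale_on_def)
  have "expectation (real_cond_exp P (\<F> 0) (?X t)) = expectation (M 0)"
    using cond X0 by (intro integral_cong_AE borel_measurable_cond_exp2) auto
  then have "expectation (?X t) = expectation (M 0)"
    using sigma_finite_subalgebra.real_cond_exp_int(2)[OF sigma_finite_subalgebra_filtration int]
    by simp
  then show "integrable P (M t) \<and> expectation (M t) = expectation (M 0)"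
    using int X Bochner_Integration.integrable_cong[of P P "?X t" "M t"]
      Bochner_Integration.integral_cong[of P P "?X t" "M t"] by simp
qed

end

section \<open>The equivalence\<close>

theorem theorem1:
  fixes P :: "'a measure" and \<gamma> :: "'a \<Rightarrow> ennreal" and F :: "real \<Rightarrow> real" and L :: "'a \<Rightarrow> real"
  assumes "prob_space P"
    and "\<gamma> \<in> borel_measurable P"
    and "measure P {\<omega> \<in> space P. \<gamma> \<omega> > 0} > 0"
    and "L \<in> borel_measurable P"
    and "cadlag_below (jump_end P \<gamma>) F"
    and "\<And>t. t \<ge> 0 \<Longrightarrow> jump_end P \<gamma> \<le> ennreal t \<Longrightarrow> continuous (at_right t) F"
  shows "(local_martingale P (single_jump_filtration P \<gamma>) (single_jump_process \<gamma> F L) \<longleftrightarrow>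
          martingale_on P (jump_times P \<gamma>) (single_jump_filtration P \<gamma>) (single_jump_process \<gamma> F L)) \<and>
         (martingale_on P (jump_times P \<gamma>) (single_jump_filtration P \<gamma>) (single_jump_process \<gamma> F L) \<longleftrightarrow>
          (\<forall>t\<in>jump_times P \<gamma>.
             integrable P (single_jump_process \<gamma> F L t) \<and>
             integral\<^sup>L P (single_jump_process \<gamma> F L t) = integral\<^sup>L P (single_jump_process \<gamma> F L 0)))"
proof -
  interpret single_jump P \<gamma> F L
    using assms by (simp add: single_jump_def single_jump_axioms_def)
  have "local_martingale P \<F> M \<longleftrightarrow> constant_mean"
    using local_martingale_imp_constant_mean constant_mean_imp_local_martingale assms(3,5,6) by blast
  then show ?thesis
    unfolding martingale_iff_constant_mean by (simp add: constant_mean_def)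
qed

end
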